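(* For every real number $\beta>1$, the beta shift $\Omega_\beta\subset\Omega_{\lceil\beta\rceil}$ is hereditary.
   Context: $\mathbb{N}=\{1,2,\ldots\}$. For $n\ge 2$, $\Lambda_n=\{0,1,\ldots,n-1\}$ and $\Omega_n=\Lambda_n^{\mathbb{N}}$ with the product topology. A subshift $X\subset\Omega_n$ (nonempty, closed, shift-invariant) is hereditary if whenever $\omega\in X$, $\omega'\in\Omega_n$ and $\omega'_i\le\omega_i$ for all $i\in\mathbb{N}$, then $\omega'\in X$. For real $\beta>1$, the expansion of $1$ in base $\beta$ is the sequence $\omega^{(\beta)}$ of nonnegative integers given by $\omega^{(\beta)}_1=\lfloor\beta\rfloor$ and $\omega^{(\beta)}_i=\left\lfloor\beta^i\left(1-\omega^{(\beta)}_1\beta^{-1}-\ldots-\omega^{(\beta)}_{i-1}\beta^{-i+1}\right)\right\rfloor$ for $i\ge2$, so that $1=\sum_{i\ge1}\omega^{(\beta)}_i\beta^{-i}$. Let $\preceq$ be the lexicographic order on $(\mathbb{N}\cup\{0\})^{\mathbb{N}}$ and $\sigma$ the shift, $(\sigma(\omega))_i=\omega_{i+1}$. The beta shift is the subshift $\Omega_\beta=\{\omega\in\Omega_{\lceil\beta\rceil}:\sigma^k(\omega)\preceq\omega^{(\beta)}\text{ for all }k\ge0\}$. *)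

theory Defs
  imports "HOL-Analysis.Analysis" "HOL-Library.Fun_Lexorder"
begin

text \<open>
  Sequences over \<open>{1, 2, \<dots>}\<close> are functions on \<^typ>\<open>nat\<close> with the index lowered by one:
  \<open>w i\<close> is the entry in position \<open>i + 1\<close>.
\<close>

definition full_shift :: "nat \<Rightarrow> (nat \<Rightarrow> nat) set" where
  "full_shift n = (UNIV \<rightarrow> {..<n})"

definition full_shift_topology :: "nat \<Rightarrow> (nat \<Rightarrow> nat) topology" where
  "full_shift_topology n = product_topology (\<lambda>_. discrete_topology {..<n}) UNIV"

lemma topspace_full_shift_topology: "topspace (full_shift_topology n) = full_shift n"
  by (auto simp: full_shift_topology_def full_shift_def)

definition shift :: "(nat \<Rightarrow> nat) \<Rightarrow> (nat \<Rightarrow> nat)" where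
  "shift w = (\<lambda>i. w (Suc i))"

definition subshift :: "nat \<Rightarrow> (nat \<Rightarrow> nat) set \<Rightarrow> bool" where
  "subshift n X \<longleftrightarrow> X \<noteq> {} \<and> closedin (full_shift_topology n) X \<and> shift ` X \<subseteq> X"

definition hereditary :: "nat \<Rightarrow> (nat \<Rightarrow> nat) set \<Rightarrow> bool" where
  "hereditary n X \<longleftrightarrow> subshift n X \<and>
     (\<forall>w\<in>X. \<forall>w'\<in>full_shift n. (\<forall>i. w' i \<le> w i) \<longrightarrow> w' \<in> X)"

definition lex_le :: "(nat \<Rightarrow> nat) \<Rightarrow> (nat \<Rightarrow> nat) \<Rightarrow> bool" where
  "lex_le u v \<longleftrightarrow> less_fun u v \<or> u = v"

text \<open>
  For \<open>i = 0\<close> the sum is empty and the first digit is \<open>\<lfloor>b\<rfloor>\<close>.  The conversion \<^const>\<open>nat\<close> truncates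
  nothing when \<open>b > 1\<close>; see \<open>int_beta_expansion\<close> below.
\<close>

fun beta_expansion :: "real \<Rightarrow> nat \<Rightarrow> nat" where
  "beta_expansion b i =
     nat \<lfloor>b ^ Suc i * (1 - (\<Sum>j<i. real (beta_expansion b j) / b ^ Suc j))\<rfloor>"

declare beta_expansion.simps [simp del]

lemma beta_expansion_remainder_nonneg:
  assumes "b > 1"
  shows "0 \<le> 1 - (\<Sum>j<i. real (beta_expansion b j) / b ^ Suc j)"
proof (induction i)
  case 0
  show ?case by simp
next
  case (Suc i)
  define r where "r = 1 - (\<Sum>j<i. real (beta_expansion b j) / b ^ Suc j)"
  have pos: "b ^ Suc i > 0" using assms by simp
  have "0 \<le> b ^ Suc i * r" using Suc pos unfolding r_def by simp
  moreover have "beta_expansion b i = nat \<lfloor>b ^ Suc i * r\<rfloor>"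
    unfolding r_def by (rule beta_expansion.simps)
  ultimately have "real (beta_expansion b i) \<le> b ^ Suc i * r"
    by (simp add: of_nat_floor)
  then have "real (beta_expansion b i) / b ^ Suc i \<le> r"
    using pos by (simp add: pos_divide_le_eq mult.commute)
  then show ?case unfolding r_def by simp
qed

lemma int_beta_expansion:
  assumes "b > 1"
  shows "int (beta_expansion b i) =
    \<lfloor>b ^ Suc i * (1 - (\<Sum>j<i. real (beta_expansion b j) / b ^ Suc j))\<rfloor>"
proof -
  have "0 \<le> b ^ Suc i * (1 - (\<Sum>j<i. real (beta_expansion b j) / b ^ Suc j))"
    using beta_expansion_remainder_nonneg[OF assms, of i] assms
    by (intro mult_nonneg_nonneg) auto
  then show ?thesis by (subst beta_expansion.simps) simp
qed

definition beta_shift :: "real \<Rightarrow> (nat \<Rightarrow> nat) set" where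
  "beta_shift b =
     {w \<in> full_shift (nat \<lceil>b\<rceil>). \<forall>k. lex_le ((shift ^^ k) w) (beta_expansion b)}"

end

theory Submission imports Defs begin

text \<open>Lowering entries cannot raise a sequence in the lexicographic order, and pointwise
  domination survives every shift. So if all shifts of \<open>w\<close> are bounded by the expansion
  of 1, the same holds for any sequence below \<open>w\<close>; this is
  \<open>lex_le_trans_pointwise\<close>. That the set is a subshift is a separate point: each
  lexicographic bound is an intersection of conditions on finitely many coordinates, hence closed
  (\<open>closedin_lex_le_shift\<close>).\<close>

lemma funpow_shift: "(shift ^^ k) w i = w (i + k)"
  by (induction k arbitrary: i) (auto simp: shift_def)

text \<open>Replaces the existence of a first difference by a conjunction over \<open>m\<close> of
  conditions that each see only the entries up to \<open>m\<close>. This form serves both the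
  closedness and the comparison argument.\<close>

lemma lex_le_iff: "lex_le u v \<longleftrightarrow> (\<forall>m. (\<forall>j<m. u j = v j) \<longrightarrow> u m \<le> v m)"
proof
  assume "lex_le u v"
  then show "\<forall>m. (\<forall>j<m. u j = v j) \<longrightarrow> u m \<le> v m"
    unfolding lex_le_def less_fun_def by (metis less_or_eq_imp_le linorder_neqE_nat less_irrefl)
next
  assume *: "\<forall>m. (\<forall>j<m. u j = v j) \<longrightarrow> u m \<le> v m"
  show "lex_le u v"
  proof (cases "u = v")
    case False
    then obtain m where "u m \<noteq> v m" "\<forall>j<m. u j = v j"
      using exists_least_iff[of "\<lambda>i. u i \<noteq> v i"] by auto
    with * show ?thesis
      unfolding lex_le_def less_fun_def by (metis le_neq_implies_less)
  qed (simp add: lex_le_def)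
qed

lemma lex_le_trans_pointwise:
  assumes "\<And>i. u i \<le> v i" and "lex_le v w"
  shows "lex_le u w"
  unfolding lex_le_iff
proof (intro allI impI)
  fix m
  assume "\<forall>j<m. u j = w j"
  then have ge: "w j \<le> v j" if "j < m" for j
    using assms(1)[of j] that by simp
  \<comment> \<open>\<open>v\<close> is squeezed: \<open>ge\<close> bounds it below by
    \<open>w\<close>, and once it agrees with \<open>w\<close> before \<open>j\<close>, the order
    bounds \<open>v j\<close> above by \<open>w j\<close>.\<close>
  have "\<forall>j<m. v j = w j"
  proof (intro allI impI)
    fix j
    assume "j < m"
    then show "v j = w j"
    proof (induction j rule: less_induct)
      case (less j)
      then have "v j \<le> w j"
        using assms(2) unfolding lex_le_iff by auto
      with ge[OF less.prems] show ?case by simp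
    qed
  qed
  then have "v m \<le> w m"
    using assms(2) unfolding lex_le_iff by blast
  with assms(1)[of m] show "u m \<le> w m" by simp
qed

text \<open>Coordinate projections are continuous into a discrete space, where every set is closed;
  hence \<open>P\<close> is arbitrary.\<close>

lemma closedin_coordinate: "closedin (full_shift_topology n) {w \<in> full_shift n. P (w i)}"
proof -
  have "continuous_map (full_shift_topology n) (discrete_topology {..<n}) (\<lambda>w. w i)"
    unfolding full_shift_topology_def
    by (rule continuous_map_product_projection[where X = "\<lambda>_. discrete_topology {..<n}"]) simp
  from closedin_continuous_map_preimage[OF this, of "{a \<in> {..<n}. P a}"]
  have "closedin (full_shift_topology n) {w \<in> full_shift n. w i \<in> {a \<in> {..<n}. P a}}"
    by (simp add: topspace_full_shift_topology Int_absorb1 subset_iff)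
  also have "{w \<in> full_shift n. w i \<in> {a \<in> {..<n}. P a}} = {w \<in> full_shift n. P (w i)}"
    by (auto simp: full_shift_def)
  finally show ?thesis .
qed

lemma closedin_lex_le_shift:
  "closedin (full_shift_topology n) {w \<in> full_shift n. lex_le ((shift ^^ k) w) v}"
proof -
  \<comment> \<open>The implication for \<open>m\<close> as a union: either an earlier entry differs
    or the bound holds at \<open>m\<close>. The union is finite, so it stays closed.\<close>
  let ?C = "\<lambda>m. (\<Union>j<m. {w \<in> full_shift n. w (j + k) \<noteq> v j}) \<union> {w \<in> full_shift n. w (m + k) \<le> v m}"
  have "closedin (full_shift_topology n) (\<Inter>m. ?C m)"
    by (intro closedin_INT closedin_Un closedin_Union closedin_coordinate)
       (auto intro: closedin_coordinate)
  also have "(\<Inter>m. ?C m) = {w \<in> full_shift n. lex_le ((shift ^^ k) w) v}"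
    by (auto simp: lex_le_iff funpow_shift)
  finally show ?thesis .
qed

lemma subshift_beta_shift:
  assumes "b > 1"
  shows "subshift (nat \<lceil>b\<rceil>) (beta_shift b)"
  unfolding subshift_def
proof (intro conjI)
  \<comment> \<open>Since \<open>b > 1\<close>, the alphabet contains 0.\<close>
  have "(\<lambda>_. 0) \<in> beta_shift b"
    using assms by (auto simp: beta_shift_def full_shift_def lex_le_iff funpow_shift)
  then show "beta_shift b \<noteq> {}" by blast
  have "beta_shift b =
      (\<Inter>k. {w \<in> full_shift (nat \<lceil>b\<rceil>). lex_le ((shift ^^ k) w) (beta_expansion b)})"
    by (auto simp: beta_shift_def)
  then show "closedin (full_shift_topology (nat \<lceil>b\<rceil>)) (beta_shift b)"
    by (auto intro: closedin_lex_le_shift)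
  show "shift ` beta_shift b \<subseteq> beta_shift b"
  proof (rule image_subsetI)
    fix w
    assume w: "w \<in> beta_shift b"
    \<comment> \<open>The conditions on \<open>shift w\<close> are those on \<open>w\<close> from
      index 1 onwards.\<close>
    then have "lex_le ((shift ^^ Suc k) w) (beta_expansion b)" for k
      unfolding beta_shift_def by blast
    with w show "shift w \<in> beta_shift b"
      by (auto simp: beta_shift_def full_shift_def shift_def funpow_swap1)
  qed
qed

theorem lemma26:
  fixes b :: real
  assumes "b > 1"
  shows "hereditary (nat \<lceil>b\<rceil>) (beta_shift b)"
  unfolding hereditary_def
proof (intro conjI ballI impI)
  show "subshift (nat \<lceil>b\<rceil>) (beta_shift b)"
    using assms by (rule subshift_beta_shift)
next
  fix w w'
  assume w: "w \<in> beta_shift b" and w': "w' \<in> full_shift (nat \<lceil>b\<rceil>)" and le: "\<forall>i. w' i \<le> w i"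
  have "lex_le ((shift ^^ k) w') (beta_expansion b)" for k
  proof (rule lex_le_trans_pointwise)
    show "(shift ^^ k) w' i \<le> (shift ^^ k) w i" for i
      using le by (simp add: funpow_shift)
    show "lex_le ((shift ^^ k) w) (beta_expansion b)"
      using w by (simp add: beta_shift_def)
  qed
  with w' show "w' \<in> beta_shift b"
    by (simp add: beta_shift_def)
qed

end
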